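(* For any $d$-dimensional $k$-Fourier-sparse signal $x:\mathbb{R}^d\to\mathbb{C}$ and any duration $T>0$, $$\max_{t\in[0,T]^d}|x(t)|^2\le k^{O(d)}\|x\|_T^2,$$ where $\|x\|_T^2=\frac{1}{T^d}\int_{[0,T]^d}|x(t)|^2\,dt$.
   Context: A $d$-dimensional $k$-Fourier-sparse signal is a function of the form $x(t)=\sum_{j=1}^k v_je^{2\pi i\langle f_j,t\rangle}$ with $v_j\in\mathbb{C}$, $f_j\in\mathbb{R}^d$. The $O(\cdot)$ hides an absolute constant. *)

theory Defs
  imports "HOL-Analysis.Analysis" "HOL-Probability.Probability"
begin

text \<open>A d-dimensional k-Fourier-sparse signal. Points of R^d are represented as
  functions nat => real, only coordinates i < d being relevant; frequency j (j < k)
  is f j :: nat => real, coefficient v j.\<close>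
definition fsparse :: "nat \<Rightarrow> nat \<Rightarrow> (nat \<Rightarrow> complex) \<Rightarrow> (nat \<Rightarrow> nat \<Rightarrow> real)
    \<Rightarrow> (nat \<Rightarrow> real) \<Rightarrow> complex" where
  "fsparse d k v f t =
     (\<Sum>j<k. v j * exp (2 * pi * \<i> * complex_of_real (\<Sum>i<d. f j i * t i)))"

definition cube :: "nat \<Rightarrow> real \<Rightarrow> (nat \<Rightarrow> real) set" where
  "cube d T = PiE {..<d} (\<lambda>_. {0..T})"

definition lebesgue_d :: "nat \<Rightarrow> (nat \<Rightarrow> real) measure" where
  "lebesgue_d d = PiM {..<d} (\<lambda>_. lborel)"

definition normT_sq :: "nat \<Rightarrow> real \<Rightarrow> ((nat \<Rightarrow> real) \<Rightarrow> complex) \<Rightarrow> real" where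
  "normT_sq d T x = (1 / T ^ d) * (LINT t : cube d T | lebesgue_d d. (cmod (x t))\<^sup>2)"

end

theory Submission
  imports Defs
begin

text \<open>
  In one dimension, sampling a sum of \<open>k\<close> exponentials with step \<open>h\<close> gives a sequence
  \<open>\<Sum>j<k. v j * z j ^ n\<close> with unimodular \<open>z j\<close>. A pigeonhole argument on the remainders of 0/1
  polynomials modulo \<open>\<Prod>j<k. (x - z j)\<close> yields a linear recurrence of length \<open>O(k^3)\<close> whose
  coefficients are bounded by 2. So the value at an endpoint is controlled by the next
  \<open>O(k^3)\<close> samples; averaging over \<open>h\<close> bounds it by the mean square, with a loss polynomial
  in \<open>k\<close>. Since freezing all coordinates but one leaves a \<open>k\<close>-sparse signal, applying this
  bound to one coordinate at a time costs a polynomial factor per dimension.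
\<close>

section \<open>Remainders of monomials modulo a product of linear factors\<close>

text \<open>Division of \<open>x ^ n\<close> by the product of the \<open>x - z j\<close>, recorded
  only through values at the nodes. For a new node \<open>w\<close>, \<open>x ^ n = w ^ n + (x - w)
  * (\<Sum>b<n. w ^ (n - Suc b) * x ^ b)\<close>, and each \<open>x ^ b\<close> is replaced by its
  remainder for the old nodes. Multiplication by \<open>x - w\<close> at most doubles the sum of the
  absolute values of the coefficients, since \<open>cmod w \<le> 1\<close>.\<close>

lemma power_remainder:
  fixes z :: "nat \<Rightarrow> complex"
  assumes "\<And>j. j < k \<Longrightarrow> cmod (z j) \<le> 1"
  shows "\<exists>r. (\<forall>j<k. z j ^ n = (\<Sum>i<k. r i * z j ^ i)) \<and> (\<forall>i\<ge>k. r i = 0) \<and>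
             (\<Sum>i<k. cmod (r i)) \<le> (2 * real n + 1) ^ k"
  using assms
proof (induction k arbitrary: n)
  case 0
  then show ?case by (intro exI[of _ "\<lambda>_. 0"]) auto
next
  case (Suc k)
  have "\<forall>b. \<exists>r. (\<forall>j<k. z j ^ b = (\<Sum>i<k. r i * z j ^ i)) \<and> (\<forall>i\<ge>k. r i = 0) \<and>
             (\<Sum>i<k. cmod (r i)) \<le> (2 * real b + 1) ^ k"
    using Suc by auto
  then obtain r where r: "\<And>b j. j < k \<Longrightarrow> z j ^ b = (\<Sum>i<k. r b i * z j ^ i)"
    and r0: "\<And>b i. i \<ge> k \<Longrightarrow> r b i = 0"
    and rb: "\<And>b. (\<Sum>i<k. cmod (r b i)) \<le> (2 * real b + 1) ^ k"
    by metis
  define w where "w = z k"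
  have w: "cmod w \<le> 1" using Suc.prems by (simp add: w_def)
  \<comment> \<open>Coefficients of \<open>x\<close> times the polynomial with coefficients
    \<open>r b\<close>, hence constant term 0.\<close>
  define sh where "sh b i = (case i of 0 \<Rightarrow> 0 | Suc i' \<Rightarrow> r b i')" for b i
  define s where "s i = (if i = 0 then w ^ n else 0) +
      (\<Sum>b<n. w ^ (n - Suc b) * (sh b i - w * r b i))" for i
  have sh_sum: "(\<Sum>i<Suc k. sh b i * x ^ i) = x * (\<Sum>i<k. r b i * x ^ i)" for b x
    unfolding sum.lessThan_Suc_shift by (simp add: sh_def sum_distrib_left mult_ac)
  have r_sum: "(\<Sum>i<Suc k. r b i * x ^ i) = (\<Sum>i<k. r b i * x ^ i)" for b x
    by (simp add: r0)
  have s_sum: "(\<Sum>i<Suc k. s i * x ^ i) =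
      w ^ n + (\<Sum>b<n. w ^ (n - Suc b) * ((x - w) * (\<Sum>i<k. r b i * x ^ i)))" for x
  proof -
    have "(\<Sum>i<Suc k. s i * x ^ i) = (\<Sum>i<Suc k. (if i = 0 then w ^ n else 0) * x ^ i) +
        (\<Sum>i<Suc k. (\<Sum>b<n. w ^ (n - Suc b) * (sh b i - w * r b i)) * x ^ i)"
      unfolding s_def by (simp only: distrib_right sum.distrib)
    also have "(\<Sum>i<Suc k. (if i = 0 then w ^ n else 0) * x ^ i) = w ^ n"
      unfolding sum.lessThan_Suc_shift by simp
    also have "(\<Sum>i<Suc k. (\<Sum>b<n. w ^ (n - Suc b) * (sh b i - w * r b i)) * x ^ i)
       = (\<Sum>b<n. \<Sum>i<Suc k. w ^ (n - Suc b) * (sh b i * x ^ i - w * (r b i * x ^ i)))"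
      unfolding sum_distrib_right by (subst sum.swap) (simp add: algebra_simps)
    also have "\<dots> = (\<Sum>b<n. w ^ (n - Suc b) *
        ((\<Sum>i<Suc k. sh b i * x ^ i) - w * (\<Sum>i<Suc k. r b i * x ^ i)))"
      by (simp only: sum_subtractf sum_distrib_left right_diff_distrib)
    finally show ?thesis unfolding sh_sum r_sum by (simp add: left_diff_distrib)
  qed
  have "z j ^ n = (\<Sum>i<Suc k. s i * z j ^ i)" if "j < Suc k" for j
  proof (cases "j = k")
    case True
    \<comment> \<open>At the new node the factor \<open>x - w\<close> vanishes, leaving
      \<open>w ^ n\<close>.\<close>
    then show ?thesis unfolding s_sum by (simp add: w_def)
  next
    case False
    then have "j < k" using that by simp
    have "z j ^ n - w ^ n = (z j - w) * (\<Sum>b<n. w ^ (n - Suc b) * z j ^ b)"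
      by (rule power_diff_sumr2)
    also have "\<dots> = (\<Sum>b<n. w ^ (n - Suc b) * ((z j - w) * (\<Sum>i<k. r b i * z j ^ i)))"
      by (simp add: r[OF \<open>j < k\<close>, symmetric] sum_distrib_left mult_ac)
    finally show ?thesis unfolding s_sum by (simp add: algebra_simps)
  qed
  moreover have "s i = 0" if "i \<ge> Suc k" for i
    using that by (cases i) (simp_all add: s_def sh_def r0)
  moreover have "(\<Sum>i<Suc k. cmod (s i)) \<le> (2 * real n + 1) ^ Suc k"
  proof -
    have "cmod (s i) \<le> (if i = 0 then 1 else 0) + (\<Sum>b<n. cmod (sh b i) + cmod (r b i))" for i
    proof -
      have "cmod (s i) \<le> cmod (if i = 0 then w ^ n else 0) +
          (\<Sum>b<n. cmod (w ^ (n - Suc b) * (sh b i - w * r b i)))"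
        unfolding s_def by (intro norm_triangle_le add_left_mono norm_sum)
      also have "\<dots> \<le> (if i = 0 then 1 else 0) + (\<Sum>b<n. cmod (sh b i) + cmod (r b i))"
      proof (intro add_mono sum_mono)
        show "cmod (if i = 0 then w ^ n else 0) \<le> (if i = 0 then 1 else 0)"
          using w by (simp add: norm_power power_le_one)
        fix b
        have "cmod (w * r b i) \<le> cmod (r b i)"
          using w by (simp add: norm_mult mult_left_le_one_le)
        then have "cmod (sh b i - w * r b i) \<le> cmod (sh b i) + cmod (r b i)"
          using norm_triangle_ineq4[of "sh b i" "w * r b i"] by linarith
        moreover have "cmod (w ^ (n - Suc b) * (sh b i - w * r b i)) \<le> cmod (sh b i - w * r b i)"
          using w by (simp add: norm_mult norm_power power_le_one mult_left_le_one_le)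
        ultimately show "cmod (w ^ (n - Suc b) * (sh b i - w * r b i)) \<le> cmod (sh b i) + cmod (r b i)"
          by linarith
      qed
      finally show ?thesis .
    qed
    then have "(\<Sum>i<Suc k. cmod (s i)) \<le>
        (\<Sum>i<Suc k. (if i = 0 then 1 else 0) + (\<Sum>b<n. cmod (sh b i) + cmod (r b i)))"
      by (intro sum_mono)
    also have "\<dots> = 1 + (\<Sum>i<Suc k. \<Sum>b<n. cmod (sh b i) + cmod (r b i))"
      unfolding sum.distrib[of _ _ "{..<Suc k}"]
      by (subst sum.lessThan_Suc_shift) simp
    also have "(\<Sum>i<Suc k. \<Sum>b<n. cmod (sh b i) + cmod (r b i)) =
        (\<Sum>b<n. (\<Sum>i<Suc k. cmod (sh b i)) + (\<Sum>i<Suc k. cmod (r b i)))"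
      by (subst sum.swap) (simp only: sum.distrib)
    also have "\<dots> = (\<Sum>b<n. 2 * (\<Sum>i<k. cmod (r b i)))"
    proof (rule sum.cong[OF refl])
      fix b
      have "(\<Sum>i<Suc k. cmod (sh b i)) = (\<Sum>i<k. cmod (r b i))"
        unfolding sum.lessThan_Suc_shift by (simp add: sh_def)
      then show "(\<Sum>i<Suc k. cmod (sh b i)) + (\<Sum>i<Suc k. cmod (r b i)) = 2 * (\<Sum>i<k. cmod (r b i))"
        by (simp add: r0)
    qed
    also have "\<dots> \<le> (\<Sum>b<n. 2 * (2 * real n + 1) ^ k)"
    proof (intro sum_mono mult_left_mono)
      fix b assume "b \<in> {..<n}"
      then have "(2 * real b + 1) ^ k \<le> (2 * real n + 1) ^ k"
        by (intro power_mono) auto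
      with rb[of b] show "(\<Sum>i<k. cmod (r b i)) \<le> (2 * real n + 1) ^ k" by linarith
    qed simp
    \<comment> \<open>With \<open>P = (2 * n + 1) ^ k \<ge> 1\<close> this is
      \<open>1 + 2 * n * P \<le> (2 * n + 1) * P\<close>.\<close>
    also have "1 + \<dots> \<le> (2 * real n + 1) ^ Suc k"
      using one_le_power[of "2 * real n + 1" k] by (simp add: algebra_simps)
    finally show ?thesis by simp
  qed
  ultimately show ?case by blast
qed

section \<open>Bounded linear recurrences by pigeonhole\<close>

text \<open>Left: the number of cells for \<open>k\<close> complex coefficients whose real and
  imaginary parts have floors of absolute value at most \<open>R = N * (2 * N + 1) ^ k\<close>.
  Right: the number of subsets of a set of \<open>32 * k ^ 3\<close> exponents. Since
  \<open>2 * N + 1 \<le> 2 ^ (7 * k)\<close>, the left side is at most 2 to the power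
  \<open>14 * k ^ 3 + 14 * k ^ 2\<close>, which is at most \<open>28 * k ^ 3\<close>.\<close>

lemma bounded_recurrence_count:
  assumes "k > 0"
  defines "N \<equiv> 33 * k ^ 3"
  shows "((2 * (N * (2 * N + 1) ^ k) + 1)\<^sup>2) ^ k < 2 ^ (32 * k ^ 3)"
proof -
  have k: "k \<le> 2 ^ (k - 1)"
    using assms(1) less_exp[of "k - 1"] by linarith
  have "1 \<le> k ^ 3" using assms(1) by simp
  then have "2 * N + 1 \<le> 2 ^ 7 * k ^ 3" unfolding N_def by simp
  also have "\<dots> \<le> 2 ^ 7 * (2 ^ (k - 1)) ^ 3"
    using k by (intro mult_left_mono power_mono) auto
  also have "\<dots> = 2 ^ (7 + (k - 1) * 3)"
    by (simp only: power_mult[symmetric] power_add)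
  also have "\<dots> \<le> 2 ^ (7 * k)"
    using assms(1) by (intro power_increasing) auto
  finally have N: "2 * N + 1 \<le> 2 ^ (7 * k)" .
  have "2 * (N * (2 * N + 1) ^ k) + 1 \<le> (2 * N + 1) ^ (k + 1)"
  proof -
    define P where "P = (2 * N + 1) ^ k"
    have "1 \<le> P" unfolding P_def by simp
    then have "2 * (N * P) + 1 \<le> P * (2 * N + 1)" by (simp add: algebra_simps)
    then show ?thesis by (simp add: P_def)
  qed
  also have "\<dots> \<le> (2 ^ (7 * k)) ^ (k + 1)"
    using N by (rule power_mono) simp
  finally have "((2 * (N * (2 * N + 1) ^ k) + 1)\<^sup>2) ^ k \<le> (((2 ^ (7 * k)) ^ (k + 1))\<^sup>2) ^ k"
    by (intro power_mono) auto
  also have "\<dots> = 2 ^ (14 * k ^ 3 + 14 * k ^ 2)"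
  proof -
    have "7 * k * (k + 1) * 2 * k = 14 * k ^ 3 + 14 * k ^ 2"
      by (simp add: algebra_simps power2_eq_square power3_eq_cube)
    then show ?thesis by (simp only: power_mult[symmetric])
  qed
  also have "\<dots> < 2 ^ (32 * k ^ 3)"
  proof -
    have "k ^ 2 \<le> k ^ 3" and "0 < k ^ 3" using assms(1) by (auto intro: power_increasing)
    then have "14 * k ^ 3 + 14 * k ^ 2 < 32 * k ^ 3" by linarith
    then show ?thesis by (intro power_strict_increasing) auto
  qed
  finally show ?thesis .
qed

text \<open>Pigeonhole over subsets of \<open>{k..<33 * k ^ 3}\<close>: two of them have power sums whose
  remainders of degree below \<open>k\<close> nearly agree. Their difference has unit leading coefficient
  at some \<open>m \<ge> k\<close>, and removing the small remainder only touches degrees below \<open>k\<close>.\<close>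

lemma bounded_recurrence:
  fixes z :: "nat \<Rightarrow> complex"
  assumes "k > 0" and z: "\<And>j. j < k \<Longrightarrow> cmod (z j) \<le> 1"
  shows "\<exists>m c. m \<le> 33 * k ^ 3 \<and> (\<forall>n<m. cmod (c n) \<le> 2) \<and>
           (\<forall>j<k. z j ^ m = (\<Sum>n<m. c n * z j ^ n))"
proof -
  define N where "N = 33 * k ^ 3"
  \<comment> \<open>Exponents start at \<open>k\<close>, so that remainders of degree below
    \<open>k\<close> never touch the leading term.\<close>
  define S where "S = {k..<k + 32 * k ^ 3}"
  \<comment> \<open>At most \<open>N\<close> remainders are added, each with coefficients bounded by
    \<open>(2 * N + 1) ^ k\<close>.\<close>
  define R where "R = N * (2 * N + 1) ^ k"
  have kN: "k + 32 * k ^ 3 \<le> N"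
    using self_le_power[of k 3] assms(1) by (simp add: N_def)
  have "\<forall>n. \<exists>r. (\<forall>j<k. z j ^ n = (\<Sum>i<k. r i * z j ^ i)) \<and> (\<forall>i\<ge>k. r i = 0) \<and>
             (\<Sum>i<k. cmod (r i)) \<le> (2 * real n + 1) ^ k"
    by (intro allI power_remainder z)
  then obtain r where r: "\<And>n j. j < k \<Longrightarrow> z j ^ n = (\<Sum>i<k. r n i * z j ^ i)"
    and rb: "\<And>n. (\<Sum>i<k. cmod (r n i)) \<le> (2 * real n + 1) ^ k"
    by metis
  define \<rho> where "\<rho> A i = (\<Sum>n\<in>A. r n i)" for A i
  have \<rho>: "(\<Sum>n\<in>A. z j ^ n) = (\<Sum>i<k. \<rho> A i * z j ^ i)" if "j < k" for A j
  proof -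
    have "(\<Sum>n\<in>A. z j ^ n) = (\<Sum>n\<in>A. \<Sum>i<k. r n i * z j ^ i)"
      by (intro sum.cong refl r that)
    then show ?thesis
      unfolding \<rho>_def sum_distrib_right by (subst sum.swap)
  qed
  have \<rho>b: "cmod (\<rho> A i) \<le> real R" if "A \<subseteq> S" "i < k" for A i
  proof -
    have "cmod (r n i) \<le> (2 * real N + 1) ^ k" if "n \<in> A" for n
    proof -
      have "cmod (r n i) \<le> (\<Sum>i<k. cmod (r n i))"
        using \<open>i < k\<close> by (intro member_le_sum) auto
      also have "\<dots> \<le> (2 * real n + 1) ^ k" by (rule rb)
      also have "\<dots> \<le> (2 * real N + 1) ^ k"
        using that \<open>A \<subseteq> S\<close> kN by (intro power_mono) (auto simp: S_def)
      finally show ?thesis .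
    qed
    then have "cmod (\<rho> A i) \<le> real (card A) * (2 * real N + 1) ^ k"
      unfolding \<rho>_def by (intro order_trans[OF norm_sum] sum_bounded_above)
    also have "\<dots> \<le> real N * (2 * real N + 1) ^ k"
    proof (intro mult_right_mono)
      have "card A \<le> card S" using that by (intro card_mono) (auto simp: S_def)
      then show "real (card A) \<le> real N" using kN by (simp add: S_def)
    qed simp
    finally show ?thesis by (simp add: R_def add.commute)
  qed
  define I where "I = {- int R..int R} \<times> {- int R..int R}"
  \<comment> \<open>The unit cells containing the remainder coefficients. Equal cells force the real
    and imaginary parts to differ by at most 1.\<close>
  define F where "F A = (\<lambda>i\<in>{..<k}. (\<lfloor>Re (\<rho> A i)\<rfloor>, \<lfloor>Im (\<rho> A i)\<rfloor>))" for A
  have floor_in: "\<lfloor>x\<rfloor> \<in> {- int R..int R}" if "\<bar>x\<bar> \<le> real R" for x :: real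
  proof -
    have "- real R \<le> x" "x \<le> real R" using that by auto
    then show ?thesis by (auto simp: le_floor_iff floor_le_iff)
  qed
  have "F ` Pow S \<subseteq> PiE {..<k} (\<lambda>_. I)"
  proof (intro subsetI)
    fix g assume "g \<in> F ` Pow S"
    then obtain A where A: "A \<subseteq> S" "g = F A" by auto
    have "(\<lfloor>Re (\<rho> A i)\<rfloor>, \<lfloor>Im (\<rho> A i)\<rfloor>) \<in> I" if "i < k" for i
      unfolding I_def
      using \<rho>b[OF A(1) that] abs_Re_le_cmod[of "\<rho> A i"] abs_Im_le_cmod[of "\<rho> A i"]
      by (intro SigmaI floor_in) auto
    then show "g \<in> PiE {..<k} (\<lambda>_. I)" by (auto simp: A(2) F_def)
  qed
  moreover have "finite (PiE {..<k} (\<lambda>_. I))"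
    by (intro finite_PiE) (auto simp: I_def)
  moreover have "card (PiE {..<k} (\<lambda>_. I)) < card (Pow S)"
  proof -
    have "card {- int R..int R} = 2 * R + 1"
      unfolding card_atLeastAtMost_int by linarith
    then have "card I = (2 * R + 1)\<^sup>2"
      by (simp only: I_def card_cartesian_product power2_eq_square)
    then have "card (PiE {..<k} (\<lambda>_. I)) = ((2 * R + 1)\<^sup>2) ^ k"
      by (simp add: card_PiE)
    also have "\<dots> < 2 ^ (32 * k ^ 3)"
      unfolding R_def N_def by (rule bounded_recurrence_count[OF assms(1)])
    finally show ?thesis by (simp add: card_Pow S_def)
  qed
  ultimately have "\<not> inj_on F (Pow S)"
    using card_inj_on_le by (metis not_le)
  then obtain A B where AB: "A \<subseteq> S" "B \<subseteq> S" "A \<noteq> B" "F A = F B"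
    by (auto simp: inj_on_def)
  define e where "e n = (of_bool (n \<in> A) - of_bool (n \<in> B) :: complex)" for n
  define \<delta> where "\<delta> i = \<rho> A i - \<rho> B i" for i
  have \<delta>: "cmod (\<delta> i) \<le> 2" if "i < k" for i
  proof -
    have "F A i = F B i" using AB by simp
    then have "\<lfloor>Re (\<rho> A i)\<rfloor> = \<lfloor>Re (\<rho> B i)\<rfloor>" "\<lfloor>Im (\<rho> A i)\<rfloor> = \<lfloor>Im (\<rho> B i)\<rfloor>"
      using that by (auto simp: F_def)
    then have "\<bar>Re (\<delta> i)\<bar> \<le> 1" "\<bar>Im (\<delta> i)\<bar> \<le> 1"
      unfolding \<delta>_def minus_complex.sel by linarith+
    then show ?thesis using cmod_le[of "\<delta> i"] by linarith
  qed
  \<comment> \<open>The largest exponent on which \<open>A\<close> and \<open>B\<close> disagree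
    becomes the order of the recurrence.\<close>
  define m where "m = Max {n \<in> S. e n \<noteq> 0}"
  have "{n \<in> S. e n \<noteq> 0} \<noteq> {}"
    using AB by (auto simp: e_def)
  then have mS: "m \<in> {n \<in> S. e n \<noteq> 0}"
    unfolding m_def by (intro Max_in) (auto simp: S_def)
  have mmax: "e n = 0" if "n \<in> S" "n > m" for n
  proof (rule ccontr)
    assume "e n \<noteq> 0"
    then have "n \<le> m" unfolding m_def using that by (intro Max_ge) (auto simp: S_def)
    then show False using that by simp
  qed
  have km: "k \<le> m" and mN: "m \<le> N" using mS kN by (auto simp: S_def)
  have em: "e m * e m = 1" using mS by (auto simp: e_def)
  have main: "(\<Sum>n\<in>{k..m}. e n * x ^ n) = (\<Sum>n\<in>A. x ^ n) - (\<Sum>n\<in>B. x ^ n)" for x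
  proof -
    have fin: "finite S" by (simp add: S_def)
    have ind: "(\<Sum>n\<in>A'. x ^ n) = (\<Sum>n\<in>S. of_bool (n \<in> A') * x ^ n)" if "A' \<subseteq> S" for A'
      using that fin by (intro sum.mono_neutral_cong_left) auto
    have "(\<Sum>n\<in>{k..m}. e n * x ^ n) = (\<Sum>n\<in>S. e n * x ^ n)"
      using mS mmax by (intro sum.mono_neutral_left) (auto simp: S_def)
    then show ?thesis
      using AB by (simp add: ind e_def left_diff_distrib sum_subtractf)
  qed
  \<comment> \<open>Solves \<open>(\<Sum>n=k..m. e n * x ^ n) = (\<Sum>i<k. \<delta> i * x ^
    i)\<close>, valid at the nodes, for \<open>x ^ m\<close>; as \<open>e m\<close> is 1 or -1,
    dividing by it is multiplying by it.\<close>
  define c where "c n = e m * (if n < k then \<delta> n else - e n)" for n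
  have cm: "cmod (e n) \<le> 1" for n by (simp add: e_def)
  have "cmod (c n) \<le> 2" for n
  proof -
    have "cmod (if n < k then \<delta> n else - e n) \<le> 2" using \<delta>[of n] cm[of n] by auto
    then show ?thesis unfolding c_def norm_mult using cm[of m]
      by (metis mult_left_le_one_le norm_ge_zero order_trans)
  qed
  moreover have "z j ^ m = (\<Sum>n<m. c n * z j ^ n)" if "j < k" for j
  proof -
    have "{..<m} = {..<k} \<union> {k..<m}" using km by auto
    then have "(\<Sum>n<m. c n * z j ^ n) = (\<Sum>n<k. c n * z j ^ n) + (\<Sum>n=k..<m. c n * z j ^ n)"
      by (simp add: sum.union_disjoint ivl_disj_int)
    also have "\<dots> = e m * (\<Sum>n<k. \<delta> n * z j ^ n) - e m * (\<Sum>n=k..<m. e n * z j ^ n)"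
      by (simp add: c_def sum_distrib_left sum_negf mult_ac)
    also have "(\<Sum>n<k. \<delta> n * z j ^ n) = (\<Sum>n\<in>{k..m}. e n * z j ^ n)"
      unfolding main \<rho>[OF that] by (simp add: \<delta>_def left_diff_distrib sum_subtractf)
    also have "{k..m} = insert m {k..<m}" using km by auto
    also have "(\<Sum>n\<in>insert m {k..<m}. e n * z j ^ n) = e m * z j ^ m + (\<Sum>n=k..<m. e n * z j ^ n)"
      by simp
    finally show ?thesis using em by (simp add: algebra_simps)
  qed
  ultimately show ?thesis using mN unfolding N_def by blast
qed

section \<open>One-dimensional exponential sums\<close>

definition exp_sum :: "nat \<Rightarrow> (nat \<Rightarrow> complex) \<Rightarrow> (nat \<Rightarrow> real) \<Rightarrow> real \<Rightarrow> complex" where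
  "exp_sum k v a u = (\<Sum>j<k. v j * cis (a j * u))"

lemma continuous_on_exp_sum [continuous_intros]:
  "continuous_on A g \<Longrightarrow> continuous_on A (\<lambda>u. exp_sum k v a (g u))"
  unfolding exp_sum_def cis_conv_exp by (intro continuous_intros)

text \<open>The number of terms is kept, so any point can be moved to the origin and, with
  \<open>\<sigma> = -1\<close>, the direction reversed.\<close>

lemma exp_sum_affine:
  "exp_sum k v a (s + \<sigma> * u) = exp_sum k (\<lambda>j. v j * cis (a j * s)) (\<lambda>j. a j * \<sigma>) u"
  by (simp add: exp_sum_def cis_mult algebra_simps)

text \<open>A recurrence of order \<open>m\<close>, run backwards from time \<open>m * h\<close>,
  expresses the value at 0 through the next \<open>m\<close> samples with coefficients at most 2.
  Cauchy-Schwarz then gives the factor \<open>4 * M\<close>.\<close>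

lemma exp_sum_le_samples:
  assumes "k > 0"
  defines "M \<equiv> 33 * k ^ 3"
  shows "(cmod (exp_sum k v a 0))\<^sup>2 \<le> 4 * real M * (\<Sum>l=1..M. (cmod (exp_sum k v a (real l * h)))\<^sup>2)"
proof -
  define y where "y = exp_sum k v a"
  \<comment> \<open>The negative angle makes multiplication by \<open>z j\<close> a step back in
    time by \<open>h\<close>.\<close>
  define z where "z j = cis (- (a j * h))" for j
  obtain m c where m: "m \<le> M" and c: "\<And>n. n < m \<Longrightarrow> cmod (c n) \<le> 2"
    and zm: "\<And>j. j < k \<Longrightarrow> z j ^ m = (\<Sum>n<m. c n * z j ^ n)"
    using bounded_recurrence[OF assms(1), of z] unfolding M_def z_def by auto
  have zn: "z j ^ n = cis (- (a j * (real n * h)))" for j n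
    by (simp add: z_def Complex.DeMoivre mult_ac)
  have "y 0 = (\<Sum>j<k. v j * cis (a j * (real m * h)) * z j ^ m)"
    by (simp add: y_def exp_sum_def zn cis_mult mult.assoc)
  also have "\<dots> = (\<Sum>j<k. v j * cis (a j * (real m * h)) * (\<Sum>n<m. c n * z j ^ n))"
    by (simp add: zm)
  also have "\<dots> = (\<Sum>n<m. \<Sum>j<k. c n * (v j * (cis (a j * (real m * h)) * z j ^ n)))"
    unfolding sum_distrib_left by (subst sum.swap) (simp add: mult_ac)
  also have "\<dots> = (\<Sum>n<m. c n * y (real (m - n) * h))"
  proof (intro sum.cong refl)
    fix n assume "n \<in> {..<m}"
    then have "cis (a j * (real m * h)) * z j ^ n = cis (a j * (real (m - n) * h))" for j
      by (simp add: zn cis_mult of_nat_diff algebra_simps)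
    then show "(\<Sum>j<k. c n * (v j * (cis (a j * (real m * h)) * z j ^ n))) = c n * y (real (m - n) * h)"
      by (simp add: y_def exp_sum_def sum_distrib_left)
  qed
  finally have "cmod (y 0) \<le> (\<Sum>n<m. cmod (c n) * cmod (y (real (m - n) * h)))"
    by (simp add: sum_norm_le norm_mult)
  also have "\<dots> \<le> (\<Sum>n<m. 2 * cmod (y (real (m - n) * h)))"
    using c by (intro sum_mono mult_right_mono) auto
  \<comment> \<open>Here \<open>l = m - n\<close>; since \<open>n < m\<close>, the value at 0 does
    not reappear on the right.\<close>
  also have "\<dots> = (\<Sum>l=1..m. 2 * cmod (y (real l * h)))"
    by (rule sum.reindex_bij_witness[of _ "\<lambda>l. m - l" "\<lambda>n. m - n"]) auto
  also have "\<dots> \<le> (\<Sum>l=1..M. 2 * cmod (y (real l * h)))"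
    using m by (intro sum_mono2) auto
  finally have "(cmod (y 0))\<^sup>2 \<le> (\<Sum>l=1..M. 2 * cmod (y (real l * h)))\<^sup>2"
    by (intro power_mono) auto
  also have "\<dots> \<le> (\<Sum>l=1..M. (2 * cmod (y (real l * h)))\<^sup>2) * real (card {1..M})"
    by (rule sum_squared_le_sum_of_squares)
  also have "\<dots> = 4 * real M * (\<Sum>l=1..M. (cmod (y (real l * h)))\<^sup>2)"
    by (simp add: power_mult_distrib sum_distrib_left mult_ac)
  finally show ?thesis by (simp add: y_def)
qed

text \<open>The sampling inequality, integrated over step sizes \<open>h\<close> in \<open>{0..L / M}\<close>.\<close>

lemma exp_sum_endpoint_bound:
  assumes "k > 0" "L > 0"
  defines "M \<equiv> 33 * k ^ 3"
  shows "L * (cmod (exp_sum k v a 0))\<^sup>2 \<le> 4 * real M ^ 3 * integral {0..L} (\<lambda>u. (cmod (exp_sum k v a u))\<^sup>2)"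
proof -
  define g where "g u = (cmod (exp_sum k v a u))\<^sup>2" for u
  define J where "J = integral {0..L} g"
  have M: "M > 0" using assms(1) by (simp add: M_def)
  have cont: "continuous_on A (\<lambda>u. g (b * u))" for A b
    unfolding g_def by (intro continuous_intros)
  have int: "(\<lambda>u. g (b * u)) integrable_on {s..t}" for s t b
    by (intro integrable_continuous_real cont)
  have int': "g integrable_on {s..t}" for s t
    using int[of 1] by simp
  \<comment> \<open>Substituting \<open>u = l * h\<close> gives \<open>1 / l\<close> times an
    integral over an initial piece of \<open>{0..L}\<close>; the factor is at most 1.\<close>
  have sample: "integral {0..L / M} (\<lambda>h. g (real l * h)) \<le> J" if l: "l \<in> {1..M}" for l
  proof -
    have l0: "real l \<ge> 1" "real l > 0" using l by auto
    have "(g has_integral integral {0..real l * (L / M)} g) {0..real l * (L / M)}"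
      using int' by (rule integrable_integral)
    from has_integral_stretch_real[OF this, of "real l"]
    have "integral {0..L / M} (\<lambda>h. g (real l * h)) = (1 / real l) * integral {0..real l * (L / M)} g"
      using l0 assms(2) by (intro integral_unique) (simp add: image_divide_atLeastAtMost)
    also have "\<dots> \<le> integral {0..real l * (L / M)} g"
      using l0 by (intro mult_left_le_one_le integral_nonneg int') (auto simp: g_def)
    also have "\<dots> \<le> J"
    proof -
      have "real l * L \<le> real M * L" using l assms(2) by (intro mult_right_mono) auto
      then have "real l * (L / M) \<le> L" using M by (simp add: field_simps)
      then show ?thesis unfolding J_def
        using int' by (intro integral_subset_le) (auto simp: g_def)
    qed
    finally show ?thesis .
  qed
  have "L / M * g 0 = integral {0..L / M} (\<lambda>h. g 0)"
    using assms(2) by simp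
  also have "\<dots> \<le> integral {0..L / M} (\<lambda>h. 4 * real M * (\<Sum>l=1..M. g (real l * h)))"
    using exp_sum_le_samples[OF assms(1), of v a] unfolding g_def M_def
    by (intro integral_le integrable_continuous_real continuous_intros) auto
  also have "\<dots> = 4 * real M * (\<Sum>l=1..M. integral {0..L / M} (\<lambda>h. g (real l * h)))"
    by (simp add: integral_sum int)
  also have "\<dots> \<le> 4 * real M * (\<Sum>l=1..M. J)"
    using sample by (intro mult_left_mono sum_mono) auto
  finally have "L / M * g 0 \<le> 4 * real M * (real M * J)" by simp
  \<comment> \<open>Two factors \<open>M\<close> come from Cauchy-Schwarz and the number of samples,
    the third from the length \<open>L / M\<close> of the range of step sizes.\<close>
  then have "L * g 0 \<le> 4 * real M ^ 3 * J"
    using M by (simp add: field_simps power3_eq_cube)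
  then show ?thesis unfolding J_def g_def .
qed

text \<open>The point \<open>t\<close> is an endpoint of a subinterval of \<open>{0..T}\<close> of length at least \<open>T / 2\<close>.\<close>

lemma exp_sum_interval_bound:
  assumes "T > 0" "t \<in> {0..T}"
  shows "(cmod (exp_sum k v a t))\<^sup>2 \<le>
    real k powr 28 * (1 / T * integral {0..T} (\<lambda>u. (cmod (exp_sum k v a u))\<^sup>2))"
proof -
  define g where "g u = (cmod (exp_sum k v a u))\<^sup>2" for u
  define J where "J = integral {0..T} g"
  have cont: "continuous_on A (\<lambda>u. g (b + c * u))" for A b c
    unfolding g_def by (intro continuous_intros)
  have int: "(\<lambda>u. g (b + c * u)) integrable_on {s..t}" for s t b c
    by (intro integrable_continuous_real cont)
  have int': "g integrable_on {s..t}" for s t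
    using int[of 0 1] by simp
  have J0: "J \<ge> 0" unfolding J_def by (intro integral_nonneg int') (simp add: g_def)
  \<comment> \<open>The power of \<open>k\<close> carries no constant in front. For
    \<open>k = 0\<close> the sum is zero and for \<open>k = 1\<close> its modulus is constant; from
    \<open>k = 2\<close> on, constants are absorbed into powers of \<open>k\<close>.\<close>
  consider "k = 0" | "k = 1" | "k \<ge> 2" by linarith
  then have "g t \<le> real k powr 28 * (1 / T * J)"
  proof cases
    case 1
    then show ?thesis by (simp add: g_def exp_sum_def)
  next
    case 2
    then have "g = (\<lambda>_. g t)" by (auto simp: g_def exp_sum_def norm_mult)
    then have "J = integral {0..T} (\<lambda>_. g t)" unfolding J_def by simp
    then show ?thesis using 2 assms(1) by simp
  next
    case 3
    define M where "M = 33 * k ^ 3"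
    \<comment> \<open>\<open>\<sigma>\<close> points from \<open>t\<close> to a farthest end of
      \<open>{0..T}\<close>, and \<open>L\<close> is the distance to it.\<close>
    obtain \<sigma> L where L: "L \<ge> T / 2" "integral {0..L} (\<lambda>u. g (t + \<sigma> * u)) \<le> J"
    proof (cases "t \<le> T / 2")
      case True
      have "(g has_integral integral {t..T} g) (cbox t T)"
        using int' by (simp add: integrable_integral)
      from has_integral_affinity[OF this, of 1 t]
      have "integral {0..T - t} (\<lambda>u. g (t + 1 * u)) = integral {t..T} g"
        using True assms(1) by (intro integral_unique) (simp add: add.commute)
      also have "\<dots> \<le> J" unfolding J_def
        using assms(2) int' by (intro integral_subset_le) (auto simp: g_def)
      finally show ?thesis using True by (intro that[of "T - t" 1]) auto
    next
      case False
      have "(g has_integral integral {0..t} g) (cbox 0 t)"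
        using int' by (simp add: integrable_integral)
      from has_integral_affinity[OF this, of "-1" t]
      have "integral {0..t} (\<lambda>u. g (t + (-1) * u)) = integral {0..t} g"
        using assms(2) by (intro integral_unique) simp
      also have "\<dots> \<le> J" unfolding J_def
        using assms(2) int' by (intro integral_subset_le) (auto simp: g_def)
      finally show ?thesis using False by (intro that[of t "-1"]) auto
    qed
    have "L > 0" using L(1) assms(1) by linarith
    have "T / 2 * g t \<le> L * g t" using L(1) by (intro mult_right_mono) (auto simp: g_def)
    also have "\<dots> = L * (cmod (exp_sum k (\<lambda>j. v j * cis (a j * t)) (\<lambda>j. a j * \<sigma>) 0))\<^sup>2"
      unfolding exp_sum_affine[symmetric] by (simp add: g_def)
    also have "\<dots> \<le> 4 * real M ^ 3 * integral {0..L} (\<lambda>u. g (t + \<sigma> * u))"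
      unfolding g_def exp_sum_affine M_def
      using 3 \<open>L > 0\<close> by (intro exp_sum_endpoint_bound) auto
    also have "\<dots> \<le> 4 * real M ^ 3 * J"
      using L(2) by (intro mult_left_mono) auto
    finally have "g t \<le> 8 * real M ^ 3 * (1 / T * J)"
      using assms(1) by (simp add: field_simps)
    also have "\<dots> \<le> real k powr 28 * (1 / T * J)"
    proof (rule mult_right_mono)
      \<comment> \<open>\<open>8 * 33 ^ 3 = 287496 < 2 ^ 19\<close>, and
        \<open>19 + 9 = 28\<close>.\<close>
      have "8 * real M ^ 3 = 287496 * real k ^ 9"
        by (simp add: M_def power_mult_distrib power_mult[symmetric])
      also have "\<dots> \<le> 2 ^ 19 * real k ^ 9" by (intro mult_right_mono) auto
      also have "\<dots> \<le> real k ^ 19 * real k ^ 9"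
        using 3 by (intro mult_right_mono power_mono) auto
      also have "\<dots> = real k powr 28"
        using 3 by (simp add: power_add[symmetric] powr_realpow)
      finally show "8 * real M ^ 3 \<le> real k powr 28" .
    qed (use J0 assms(1) in simp)
    finally show ?thesis .
  qed
  then show ?thesis unfolding J_def g_def .
qed

section \<open>Slices of sparse signals and integration over the cube\<close>

lemma fsparse_update_last:
  "fsparse (Suc d) k v f (u(d := y)) =
     exp_sum k (\<lambda>j. v j * cis (2 * pi * (\<Sum>i<d. f j i * u i))) (\<lambda>j. 2 * pi * f j d) y"
  by (simp add: fsparse_def exp_sum_def cis_conv_exp exp_add[symmetric] algebra_simps)

lemma fsparse_freeze_last:
  "fsparse (Suc d) k v f (u(d := y)) = fsparse d k (\<lambda>j. v j * cis (2 * pi * f j d * y)) f u"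
  by (simp add: fsparse_def cis_conv_exp exp_add[symmetric] algebra_simps)

lemma fsparse_restrict: "fsparse d k v f (restrict t {..<d}) = fsparse d k v f t"
  by (simp add: fsparse_def)

lemma cmod_fsparse_le: "cmod (fsparse d k v f t) \<le> (\<Sum>j<k. cmod (v j))"
  unfolding fsparse_def by (rule sum_norm_le) (simp add: norm_mult)

interpretation lborel_family: product_sigma_finite "\<lambda>_::nat. lborel :: real measure"
  by standard

lemma space_lebesgue_d: "space (lebesgue_d d) = extensional {..<d}"
  by (auto simp: lebesgue_d_def space_PiM PiE_def)

lemma cube_in_sets [measurable]: "cube d T \<in> sets (lebesgue_d d)"
  unfolding cube_def lebesgue_d_def by (intro sets_PiM_I_finite) auto

lemma emeasure_cube_finite: "emeasure (lebesgue_d d) (cube d T) < \<infinity>"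
  unfolding cube_def lebesgue_d_def
  by (subst lborel_family.emeasure_PiM) (auto simp: power_less_top_ennreal emeasure_lborel_Icc_eq)

lemma fsparse_measurable [measurable]: "fsparse d k v f \<in> borel_measurable (lebesgue_d d)"
proof -
  have "(\<lambda>t. t i) \<in> borel_measurable (lebesgue_d d)" if "i < d" for i
    unfolding lebesgue_d_def
    using measurable_component_singleton[of i "{..<d}" "\<lambda>_. lborel :: real measure"] that by simp
  then have [measurable]: "(\<lambda>t. \<Sum>i<d. f j i * t i) \<in> borel_measurable (lebesgue_d d)" for j
    by (intro borel_measurable_sum borel_measurable_times) auto
  show ?thesis unfolding fsparse_def by measurable
qed

lemma integrable_cube_fsparse:
  "integrable (lebesgue_d d) (\<lambda>u. indicator (cube d T) u *\<^sub>R (cmod (fsparse d k v f u))\<^sup>2)"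
  by (rule integrableI_bounded_set_indicator[where B = "(\<Sum>j<k. cmod (v j))\<^sup>2"])
    (auto simp: emeasure_cube_finite[unfolded infinity_ennreal_def] cmod_fsparse_le intro!: power_mono)

text \<open>Membership in \<open>PiE\<close> includes being \<open>undefined\<close> off the index
  set. The update overwrites the value at \<open>d\<close>, so the factorization relies on
  \<open>u\<close> being extensional beforehand.\<close>

lemma indicator_cube_update:
  assumes "u \<in> space (lebesgue_d d)"
  shows "indicator (cube (Suc d) T) (u(d := y)) = (indicator (cube d T) u * indicator {0..T} y :: real)"
  using assms
  by (auto simp: space_lebesgue_d cube_def indicator_def PiE_iff extensional_def less_Suc_eq)

text \<open>Fubini with the last coordinate innermost. Integrability of \<open>H\<close> is what
  later allows a pointwise bound to be integrated.\<close>

lemma normT_sq_Suc: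
  fixes v f k T d
  defines "H \<equiv> (\<lambda>u. indicator (cube d T) u *
    integral {0..T} (\<lambda>y. (cmod (fsparse (Suc d) k v f (u(d := y))))\<^sup>2))"
  shows "normT_sq (Suc d) T (fsparse (Suc d) k v f) = 1 / T ^ Suc d * (\<integral>u. H u \<partial>lebesgue_d d)"
    and "integrable (lebesgue_d d) H"
proof -
  define F where "F t = indicator (cube (Suc d) T) t *\<^sub>R (cmod (fsparse (Suc d) k v f t))\<^sup>2" for t
  have leb: "lebesgue_d (Suc d) = PiM (insert d {..<d}) (\<lambda>_. lborel)"
    by (simp add: lebesgue_d_def lessThan_Suc)
  have cont: "continuous_on A (\<lambda>y. (cmod (fsparse (Suc d) k v f (u(d := y))))\<^sup>2)" for A u
    unfolding fsparse_update_last by (intro continuous_intros)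
  have H: "(\<integral>y. F (u(d := y)) \<partial>lborel) = H u" if u: "u \<in> space (lebesgue_d d)" for u
  proof -
    have "(\<integral>y. F (u(d := y)) \<partial>lborel) = indicator (cube d T) u *
        (LINT y:{0..T}|lborel. (cmod (fsparse (Suc d) k v f (u(d := y))))\<^sup>2)"
      by (simp add: F_def indicator_cube_update[OF u] set_lebesgue_integral_def mult.assoc)
    \<comment> \<open>Continuity in \<open>y\<close> identifies the Lebesgue integral with the gauge
      integral used in one dimension.\<close>
    also have "\<dots> = H u"
      unfolding H_def by (simp add: set_borel_integral_eq_integral(2) borel_integrable_atLeastAtMost' cont)
    finally show ?thesis .
  qed
  have "normT_sq (Suc d) T (fsparse (Suc d) k v f) = 1 / T ^ Suc d * (\<integral>t. F t \<partial>lebesgue_d (Suc d))"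
    by (simp add: normT_sq_def set_lebesgue_integral_def F_def)
  also have "(\<integral>t. F t \<partial>lebesgue_d (Suc d)) = (\<integral>u. (\<integral>y. F (u(d := y)) \<partial>lborel) \<partial>lebesgue_d d)"
    unfolding leb using integrable_cube_fsparse[of "Suc d" T k v f]
    by (subst lborel_family.product_integral_insert)
      (simp_all add: F_def[abs_def] leb lebesgue_d_def[of d])
  also have "\<dots> = (\<integral>u. H u \<partial>lebesgue_d d)"
    by (intro Bochner_Integration.integral_cong refl H)
  finally show "normT_sq (Suc d) T (fsparse (Suc d) k v f) = 1 / T ^ Suc d * (\<integral>u. H u \<partial>lebesgue_d d)" .
  show "integrable (lebesgue_d d) H"
  \<comment> \<open>\<open>H\<close> is bounded and vanishes off a set of finite measure;
    \<open>max 0 T\<close> covers negative \<open>T\<close>, where \<open>{0..T}\<close> is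
    empty.\<close>
  proof (rule integrableI_bounded_set[where A = "cube d T" and B = "(\<Sum>j<k. cmod (v j))\<^sup>2 * max 0 T"])
    have Fm: "F \<in> borel_measurable (PiM (insert d {..<d}) (\<lambda>_. lborel))"
      unfolding F_def leb[symmetric] by measurable
    have "(\<lambda>p. F ((fst p)(d := snd p))) \<in> borel_measurable (lebesgue_d d \<Otimes>\<^sub>M lborel)"
      using measurable_compose[OF measurable_add_dim Fm]
      by (simp add: lebesgue_d_def case_prod_beta)
    then have "(\<lambda>u. \<integral>y. F (u(d := y)) \<partial>lborel) \<in> borel_measurable (lebesgue_d d)"
      by (intro lborel.borel_measurable_lebesgue_integral) (simp add: case_prod_beta)
    then show "H \<in> borel_measurable (lebesgue_d d)"
      using H by (simp cong: measurable_cong)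
    have "norm (H u) \<le> (\<Sum>j<k. cmod (v j))\<^sup>2 * max 0 T" for u
    proof (cases "T \<ge> 0")
      case True
      have "norm (integral {0..T} (\<lambda>y. (cmod (fsparse (Suc d) k v f (u(d := y))))\<^sup>2)) \<le>
          (\<Sum>j<k. cmod (v j))\<^sup>2 * (T - 0)"
        using True cont by (intro integral_bound) (auto intro!: power_mono cmod_fsparse_le)
      then show ?thesis
        using True by (auto simp: H_def indicator_def)
    next
      case False
      then show ?thesis by (simp add: H_def)
    qed
    then show "AE u in lebesgue_d d. u \<in> cube d T \<longrightarrow> norm (H u) \<le> (\<Sum>j<k. cmod (v j))\<^sup>2 * max 0 T"
      by simp
  qed (auto simp: emeasure_cube_finite[unfolded infinity_ennreal_def] H_def)
qed

section \<open>Induction on the dimension\<close>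

text \<open>The induction hypothesis bounds the value at \<open>t\<close> by the mean square of the
  slice through \<open>t d\<close>. For each \<open>u\<close>, the one-dimensional bound controls
  the slice at \<open>u\<close> by \<open>k powr 28\<close> times a mean over the last coordinate;
  integrating over \<open>u\<close> recovers the full mean square. The coefficients stay arbitrary
  because freezing a coordinate changes them.\<close>

lemma fsparse_cube_bound:
  assumes T: "T > 0" and "t \<in> cube d T"
  shows "(cmod (fsparse d k v f t))\<^sup>2 \<le> real k powr (28 * real d) * normT_sq d T (fsparse d k v f)"
  using assms(2)
proof (induction d arbitrary: v t)
  case 0
  \<comment> \<open>The product measure over no coordinates is a unit point mass.\<close>
  have "normT_sq 0 T (fsparse 0 k v f) = (cmod (\<Sum>j<k. v j))\<^sup>2"
    by (simp add: normT_sq_def set_lebesgue_integral_def lebesgue_d_def cube_def fsparse_def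
        PiM_empty lebesgue_integral_count_space_finite)
  moreover have "fsparse 0 k v f t = (\<Sum>j<k. v j)"
    by (simp add: fsparse_def)
  \<comment> \<open>\<open>0 powr 0\<close> is 0, so \<open>k = 0\<close> is separate: there the sum
    is empty.\<close>
  moreover have "real k powr (28 * real 0) * (cmod (\<Sum>j<k. v j))\<^sup>2 = (cmod (\<Sum>j<k. v j))\<^sup>2"
    by (cases "k = 0") simp_all
  ultimately show ?case by (simp only: order_refl)
next
  case (Suc d)
  define x where "x = fsparse (Suc d) k v f"
  define w where "w j = v j * cis (2 * pi * f j d * t d)" for j
  define K where "K = real k powr 28"
  \<comment> \<open>\<open>t\<close> is extensional on \<open>{..<Suc d}\<close> and must be cut
    down to lie in \<open>cube d T\<close>.\<close>
  define u\<^sub>0 where "u\<^sub>0 = restrict t {..<d}"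
  define H where "H u = indicator (cube d T) u * integral {0..T} (\<lambda>y. (cmod (x (u(d := y))))\<^sup>2)" for u
  have mem: "t i \<in> {0..T}" if "i < Suc d" for i
    using PiE_mem[OF Suc.prems[unfolded cube_def], of i] that by simp
  then have td: "t d \<in> {0..T}" by blast
  have u0: "u\<^sub>0 \<in> cube d T"
    unfolding cube_def u\<^sub>0_def using mem by (simp add: restrict_PiE_iff)
  have "x t = fsparse d k w f t"
    using fsparse_freeze_last[of d k v f t "t d"] unfolding x_def w_def[abs_def] by (simp only: fun_upd_triv)
  then have "x t = fsparse d k w f u\<^sub>0"
    by (simp only: u\<^sub>0_def fsparse_restrict)
  then have upper: "(cmod (x t))\<^sup>2 \<le> real k powr (28 * real d) * normT_sq d T (fsparse d k w f)"
    using Suc.IH[OF u0, of w] by (simp only:)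
  have "normT_sq d T (fsparse d k w f) \<le> K * normT_sq (Suc d) T x"
  proof -
    have "(\<integral>u. indicator (cube d T) u *\<^sub>R (cmod (fsparse d k w f u))\<^sup>2 \<partial>lebesgue_d d)
        \<le> (\<integral>u. K * (1 / T) * H u \<partial>lebesgue_d d)"
    proof (rule integral_mono)
      show "integrable (lebesgue_d d) (\<lambda>u. K * (1 / T) * H u)"
        unfolding H_def x_def by (intro integrable_mult_right normT_sq_Suc(2))
      fix u
      have "fsparse d k w f u = x (u(d := t d))"
        unfolding x_def w_def by (rule fsparse_freeze_last[symmetric])
      then have "(cmod (fsparse d k w f u))\<^sup>2 \<le>
          K * (1 / T * integral {0..T} (\<lambda>y. (cmod (x (u(d := y))))\<^sup>2))"
        unfolding x_def K_def fsparse_update_last using exp_sum_interval_bound[OF T td] by simp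
      then show "indicator (cube d T) u *\<^sub>R (cmod (fsparse d k w f u))\<^sup>2 \<le> K * (1 / T) * H u"
        by (simp add: H_def indicator_def)
    qed (rule integrable_cube_fsparse)
    also have "\<dots> = K * (1 / T) * (\<integral>u. H u \<partial>lebesgue_d d)" by simp
    finally have "normT_sq d T (fsparse d k w f) \<le> 1 / T ^ d * (K * (1 / T) * (\<integral>u. H u \<partial>lebesgue_d d))"
      unfolding normT_sq_def set_lebesgue_integral_def using T by (intro mult_left_mono) auto
    also have "\<dots> = K * normT_sq (Suc d) T x"
      unfolding x_def normT_sq_Suc(1) H_def by simp
    finally show ?thesis .
  qed
  then have "real k powr (28 * real d) * normT_sq d T (fsparse d k w f) \<le>
      real k powr (28 * real d) * (K * normT_sq (Suc d) T x)"
    by (intro mult_left_mono) auto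
  also have "\<dots> =
      real k powr (28 * real (Suc d)) * normT_sq (Suc d) T x"
  proof -
    have "28 * real (Suc d) = 28 * real d + 28" by simp
    then show ?thesis unfolding K_def by (simp only: powr_add mult.assoc)
  qed
  finally show ?case using upper unfolding x_def by linarith
qed

theorem theorem5p3:
  shows "\<exists>C::real. \<forall>(d::nat) (k::nat) (v::nat \<Rightarrow> complex) (f::nat \<Rightarrow> nat \<Rightarrow> real) (T::real).
           T > 0 \<longrightarrow>
           (\<forall>t \<in> cube d T. (cmod (fsparse d k v f t))\<^sup>2
               \<le> real k powr (C * real d) * normT_sq d T (fsparse d k v f))"
  using fsparse_cube_bound by blast

end
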